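(* Let $n\ge 1$, let $t_0\in\mathbb{R}$ and $t_0<T\le+\infty$, and let $A,B,F$ be continuous $n\times n$ matrix-valued functions (with real or complex entries) on $[t_0,T)$. Let $X_0$ be an $n\times n$ matrix and suppose that the differentiable $n\times n$ matrix-valued function $X$ on $[t_0,T)$ solves the initial value problem $$\frac{\mathrm{d}}{\mathrm{d}t}X(t)+A(t)X(t)+X(t)B(t)=F(t)\quad (t\in[t_0,T)),\qquad X(t_0)=X_0 .$$ Then for every $t\in[t_0,T)$, $$\det X(t)=e^{-\int_{t_0}^{t}\operatorname{tr}[A(\xi)+B(\xi)]\,\mathrm{d}\xi}\left\{\int_{t_0}^{t}\operatorname{tr}\big[X^{\#}(s)F(s)\big]\,e^{\int_{t_0}^{s}\operatorname{tr}[A(\xi)+B(\xi)]\,\mathrm{d}\xi}\,\mathrm{d}s+\det X_0\right\}.$$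
   Context: For a square matrix $X$, $X^{\#}$ denotes its adjugate (the transpose of the cofactor matrix), so that $XX^{\#}=X^{\#}X=\det(X)\,I$; $X^{\#}(s)$ means the adjugate of $X(s)$. $\operatorname{tr}$ denotes the trace. The derivative at the left endpoint $t_0$ is the one-sided (right) derivative. *)

theory Defs
  imports "HOL-Analysis.Analysis"
begin

text \<open>
  The index type \<open>'n\<close> carries no order, so the signed minor cannot be written as
  \<open>(-1)^(i+j)\<close> times the determinant of a submatrix. Instead, row \<open>i\<close> and column \<open>j\<close> are
  overwritten by the corresponding unit vectors, with the \<open>1\<close> in position \<open>(i, j)\<close>; expanding
  along row \<open>i\<close> shows that the determinant of this full-size matrix is the cofactor, sign included.
\<close>

definition cofactor :: "'a::comm_ring_1^'n^'n \<Rightarrow> 'n \<Rightarrow> 'n \<Rightarrow> 'a" where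
  "cofactor A i j =
     det (\<chi> k l. if k = i \<and> l = j then 1 else if k = i \<or> l = j then 0 else A $ k $ l)"

definition adjugate :: "'a::comm_ring_1^'n^'n \<Rightarrow> 'a^'n^'n" where
  "adjugate A = transpose (\<chi> i j. cofactor A i j)"

lemma cofactor_row_replaced:
  fixes A :: "'a::comm_ring_1^'n^'n"
  shows "cofactor A i j = det (\<chi> k. if k = i then axis j 1 else A $ k)"
  unfolding cofactor_def det_def
proof (rule sum.cong[OF refl])
  fix p assume "p \<in> {p. p permutes (UNIV :: 'n set)}"
  then have inj: "p k = p i \<longleftrightarrow> k = i" for k
    by (auto dest: permutes_inj injD)
  let ?f = "\<lambda>k. (\<chi> k l. if k = i \<and> l = j then 1 else if k = i \<or> l = j then 0 else A $ k $ l) $ k $ p k"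
  let ?g = "\<lambda>k. (\<chi> k. if k = i then axis j 1 else A $ k) $ k $ p k"
  have "prod ?f UNIV = prod ?g UNIV"
  proof (cases "p i = j")
    case True
    then show ?thesis
      using inj by (intro prod.cong) (auto simp: axis_def)
  next
    case False
    then have "?f i = 0" "?g i = 0"
      by (auto simp: axis_def)
    then have "prod ?f UNIV = 0" "prod ?g UNIV = 0"
      by (metis (no_types, lifting) UNIV_I finite prod_zero)+
    then show ?thesis by simp
  qed
  then show "of_int (sign p) * prod ?f UNIV = of_int (sign p) * prod ?g UNIV"
    by simp
qed

lemma cofactor_transpose: "cofactor (transpose A) i j = cofactor A j i"
proof -
  have "cofactor (transpose A) i j =
      det (transpose (\<chi> k l. if k = j \<and> l = i then 1 else if k = j \<or> l = i then 0 else A $ k $ l))"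
    unfolding cofactor_def
    by (rule arg_cong[where f = det]) (auto simp: vec_eq_iff transpose_def)
  then show ?thesis
    by (simp add: cofactor_def)
qed

lemma adjugate_transpose: "adjugate (transpose A) = transpose (adjugate A)"
  by (simp add: adjugate_def vec_eq_iff transpose_def cofactor_transpose[unfolded transpose_def])

lemma mult_adjugate:
  fixes A :: "'a::comm_ring_1^'n^'n"
  shows "A ** adjugate A = mat (det A)"
proof -
  have "(\<Sum>k\<in>UNIV. A $ i $ k * cofactor A j k) = (if i = j then det A else 0)" for i j
  proof -
    have "(\<Sum>k\<in>UNIV. A $ i $ k * cofactor A j k) =
        (\<Sum>k\<in>UNIV. det (\<chi> l. if l = j then A $ i $ k *s axis k 1 else A $ l))"
      by (simp add: cofactor_row_replaced det_row_mul)
    also have "\<dots> = det (\<chi> l. if l = j then (\<Sum>k\<in>UNIV. A $ i $ k *s axis k 1) else A $ l)"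
      by (rule det_linear_row_sum[symmetric]) simp
    also have "\<dots> = det (\<chi> l. if l = j then A $ i else A $ l)"
      by (simp only: basis_expansion)
    also have "\<dots> = (if i = j then det A else 0)"
    proof (cases "i = j")
      case True
      then have "(\<chi> l. if l = j then A $ i else A $ l) = A"
        by (simp add: vec_eq_iff)
      with True show ?thesis by simp
    next
      case False
      then show ?thesis
        using det_identical_rows[of i j "\<chi> l. if l = j then A $ i else A $ l"]
        by (simp add: row_def)
    qed
    finally show ?thesis .
  qed
  then show ?thesis
    by (simp add: vec_eq_iff matrix_matrix_mult_def adjugate_def transpose_def mat_def)
qed

lemma adjugate_mult:
  fixes A :: "'a::comm_ring_1^'n^'n"
  shows "adjugate A ** A = mat (det A)"
proof -
  have "transpose (adjugate A ** A) = transpose A ** adjugate (transpose A)"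
    by (simp add: matrix_transpose_mul adjugate_transpose)
  also have "\<dots> = mat (det A)"
    by (simp add: mult_adjugate)
  finally show ?thesis
    by (metis transpose_mat transpose_transpose)
qed

end

theory Submission
  imports Defs
begin

text \<open>
  By Jacobi's formula \<open>(det X)' = tr (adj X ** X')\<close>, the matrix equation turns into the
  scalar linear equation \<open>(det X)' + tr (A + B) * det X = tr (adj X ** F)\<close>, since cyclicity of the
  trace and \<open>X ** adj X = adj X ** X = det X\<close> evaluate the terms with \<open>A\<close> and \<open>B\<close>.
  The integrating factor \<open>exp (\<integral> tr (A + B))\<close> then solves it.
\<close>

lemma has_vector_derivative_prod:
  fixes f :: "'i \<Rightarrow> real \<Rightarrow> 'a::real_normed_field"
  assumes "\<And>i. i \<in> J \<Longrightarrow> (f i has_vector_derivative f' i) (at t within S)"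
  shows "((\<lambda>t. \<Prod>i\<in>J. f i t) has_vector_derivative (\<Sum>i\<in>J. f' i * (\<Prod>k\<in>J - {i}. f k t)))
    (at t within S)"
  using has_derivative_prod[of J f "\<lambda>i x. x *\<^sub>R f' i" t S] assms
  by (simp add: has_vector_derivative_def scaleR_sum_right)

lemma has_vector_derivative_vec_nth:
  assumes "(X has_vector_derivative X') F"
  shows "((\<lambda>t. X t $ i) has_vector_derivative X' $ i) F"
  using bounded_linear.has_vector_derivative[OF bounded_linear_vec_nth assms] .

text \<open>Laplace expansion along row \<open>i\<close>: the determinant is linear in that row, and
  a unit vector in it yields a cofactor.\<close>

lemma det_replace_row:
  fixes A :: "'a::comm_ring_1^'n^'n"
  shows "det (\<chi> k. if k = i then v else A $ k) = (\<Sum>j\<in>UNIV. v $ j * cofactor A i j)"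
proof -
  have "det (\<chi> k. if k = i then v else A $ k) =
      det (\<chi> k. if k = i then (\<Sum>j\<in>UNIV. v $ j *s axis j 1) else A $ k)"
    by (simp only: basis_expansion)
  also have "\<dots> = (\<Sum>j\<in>UNIV. det (\<chi> k. if k = i then v $ j *s axis j 1 else A $ k))"
    by (rule det_linear_row_sum) simp
  also have "\<dots> = (\<Sum>j\<in>UNIV. v $ j * cofactor A i j)"
    by (simp add: cofactor_row_replaced det_row_mul)
  finally show ?thesis .
qed

lemma trace_adjugate_mult:
  fixes A :: "'a::comm_ring_1^'n^'n"
  shows "trace (adjugate A ** M) = (\<Sum>i\<in>UNIV. det (\<chi> k. if k = i then M $ i else A $ k))"
  \<comment> \<open>With \<open>M\<close> on the left, the \<open>i\<close>-th diagonal entry pairs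
    row \<open>i\<close> of \<open>M\<close> with the cofactors of row \<open>i\<close> of
    \<open>A\<close>, which is a row expansion.\<close>
  unfolding trace_mul_sym[of "adjugate A"]
  by (simp add: det_replace_row trace_def matrix_matrix_mult_def adjugate_def transpose_def)

text \<open>Jacobi's formula. The product rule on each term of the Leibniz expansion differentiates
  one row at a time; summing over permutations first gives determinants with a single row replaced
  by its derivative.\<close>

lemma has_vector_derivative_det:
  fixes X :: "real \<Rightarrow> 'a::real_normed_field^'n^'n"
  assumes "(X has_vector_derivative X') (at t within S)"
  shows "((\<lambda>t. det (X t)) has_vector_derivative trace (adjugate (X t) ** X')) (at t within S)"
proof -
  have row: "(\<Prod>k\<in>UNIV. (\<chi> k. if k = i then X' $ i else X t $ k) $ k $ p k) =
      X' $ i $ p i * (\<Prod>k\<in>UNIV - {i}. X t $ k $ p k)" for i :: 'n and p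
    by (subst prod.remove[of UNIV i]) auto
  have "((\<lambda>t. det (X t)) has_vector_derivative
      (\<Sum>p | p permutes UNIV. of_int (sign p) *
        (\<Sum>i\<in>UNIV. X' $ i $ p i * (\<Prod>k\<in>UNIV - {i}. X t $ k $ p k)))) (at t within S)"
    unfolding det_def
    by (intro has_vector_derivative_sum has_vector_derivative_mult_right
        has_vector_derivative_prod has_vector_derivative_vec_nth assms)
  also have "(\<Sum>p | p permutes UNIV. of_int (sign p) *
        (\<Sum>i\<in>UNIV. X' $ i $ p i * (\<Prod>k\<in>UNIV - {i}. X t $ k $ p k))) =
      trace (adjugate (X t) ** X')"
    unfolding trace_adjugate_mult det_def row sum_distrib_left by (rule sum.swap)
  finally show ?thesis .
qed

lemma trace_mult_mat:
  fixes A :: "'a::comm_ring_1^'n^'n"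
  shows "trace (A ** mat c) = trace A * c"
  by (simp add: trace_def matrix_matrix_mult_def mat_def sum_distrib_right if_distrib cong: if_cong)

lemma trace_adjugate_sylvester:
  fixes A B X :: "'a::comm_ring_1^'n^'n"
  shows "trace (adjugate X ** (A ** X + X ** B)) = trace (A + B) * det X"
proof -
  have "trace (adjugate X ** (A ** X)) = trace (A ** (X ** adjugate X))"
    by (metis matrix_mul_assoc trace_mul_sym)
  moreover have "trace (adjugate X ** (X ** B)) = trace (B ** (adjugate X ** X))"
    by (metis matrix_mul_assoc trace_mul_sym)
  ultimately show ?thesis
    by (simp add: matrix_add_ldistrib trace_add mult_adjugate adjugate_mult trace_mult_mat
        distrib_right)
qed

lemma continuous_on_trace:
  fixes A :: "real \<Rightarrow> 'a::real_normed_field^'n^'n"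
  assumes "continuous_on S A"
  shows "continuous_on S (\<lambda>t. trace (A t))"
  unfolding trace_def by (intro continuous_intros assms)

text \<open>The integrating factor \<open>exp (integral {a..s} g)\<close> turns the equation
  \<open>d' = h - g * d\<close> into an exact derivative.\<close>

lemma linear_ode_solution:
  fixes d g h :: "real \<Rightarrow> 'a::{real_normed_field, euclidean_space}"
  assumes "a \<le> b" and g: "continuous_on {a..b} g"
    and d: "\<And>s. s \<in> {a..b} \<Longrightarrow> (d has_vector_derivative h s - g s * d s) (at s within {a..b})"
  shows "d b = exp (- integral {a..b} g) *
    (integral {a..b} (\<lambda>s. h s * exp (integral {a..s} g)) + d a)"
proof -
  let ?E = "\<lambda>s. exp (integral {a..s} g)"
  have E: "(?E has_vector_derivative g s * ?E s) (at s within {a..b})" if "s \<in> {a..b}" for s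
    using field_vector_diff_chain_within
      [OF integral_has_vector_derivative[OF g that], where g = exp, OF DERIV_subset[OF DERIV_exp]]
    by (simp add: o_def)
  have "((\<lambda>s. d s * ?E s) has_vector_derivative h s * ?E s) (at s within {a..b})"
    if "s \<in> {a..b}" for s
    using has_vector_derivative_mult[OF d[OF that] E[OF that]] by (simp add: algebra_simps)
  \<comment> \<open>Integrability of \<open>h s * ?E s\<close> comes from its having the
    antiderivative \<open>d s * ?E s\<close>.\<close>
  then have "((\<lambda>s. h s * ?E s) has_integral d b * ?E b - d a * ?E a) {a..b}"
    using \<open>a \<le> b\<close> by (intro fundamental_theorem_of_calculus)
  then have "integral {a..b} (\<lambda>s. h s * ?E s) + d a = d b * ?E b"
    by (simp add: integral_unique)
  then show ?thesis
    by (simp add: exp_minus)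
qed

text \<open>The sort of \<open>'a\<close> covers both real and complex entries, \<open>T\<close> in
  \<open>ereal\<close> admits an infinite endpoint, and differentiating within \<open>I\<close>
  makes the derivative at \<open>t0\<close> one-sided.\<close>

theorem theorem2:
  fixes A B F X X' :: "real \<Rightarrow> 'a::{real_normed_field, euclidean_space}^'n^'n"
    and X0 :: "'a^'n^'n"
    and t0 :: real and T :: ereal and I :: "real set"
  assumes t0_less_T: "ereal t0 < T"
    and I_def: "I = {t. t0 \<le> t \<and> ereal t < T}"
    and cont: "continuous_on I A" "continuous_on I B" "continuous_on I F"
    and deriv: "\<And>t. t \<in> I \<Longrightarrow> (X has_vector_derivative X' t) (at t within I)"
    and ode: "\<And>t. t \<in> I \<Longrightarrow> X' t + A t ** X t + X t ** B t = F t"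
    and init: "X t0 = X0"
  shows "\<forall>t\<in>I. det (X t) =
    exp (- integral {t0..t} (\<lambda>\<xi>. trace (A \<xi> + B \<xi>))) *
    (integral {t0..t} (\<lambda>s. trace (adjugate (X s) ** F s) *
       exp (integral {t0..s} (\<lambda>\<xi>. trace (A \<xi> + B \<xi>)))) + det X0)"
proof
  fix t assume t: "t \<in> I"
  \<comment> \<open>For fixed \<open>t\<close>, everything is restricted to the compact interval
    \<open>{t0..t}\<close>, where the scalar equation is solved.\<close>
  have sub: "{t0..t} \<subseteq> I"
    using t by (auto simp: I_def intro: le_less_trans[of "ereal _" "ereal t" T])
  have "continuous_on {t0..t} (\<lambda>s. trace (A s + B s))"
    by (intro continuous_on_trace continuous_on_add continuous_on_subset[OF _ sub] cont)
  moreover have "((\<lambda>s. det (X s)) has_vector_derivative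
      trace (adjugate (X s) ** F s) - trace (A s + B s) * det (X s)) (at s within {t0..t})"
    if "s \<in> {t0..t}" for s
  proof -
    have s: "s \<in> I" using that sub by blast
    have "trace (adjugate (X s) ** F s) =
        trace (adjugate (X s) ** X' s) + trace (A s + B s) * det (X s)"
      unfolding ode[OF s, symmetric] add.assoc
      \<comment> \<open>The instantiations split off only \<open>X' s\<close>, so that
        \<open>A s ** X s + X s ** B s\<close> stays together for
        \<open>trace_adjugate_sylvester\<close>.\<close>
      by (simp only: matrix_add_ldistrib[of _ "X' s"] trace_add[of "_ ** X' s"]
          trace_adjugate_sylvester)
    then show ?thesis
      using has_vector_derivative_within_subset[OF has_vector_derivative_det[OF deriv[OF s]] sub]
      by simp
  qed
  ultimately show "det (X t) =
      exp (- integral {t0..t} (\<lambda>\<xi>. trace (A \<xi> + B \<xi>))) *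
      (integral {t0..t} (\<lambda>s. trace (adjugate (X s) ** F s) *
         exp (integral {t0..s} (\<lambda>\<xi>. trace (A \<xi> + B \<xi>)))) + det X0)"
    using linear_ode_solution[where d = "\<lambda>s. det (X s)" and a = t0 and b = t] t
    by (simp add: I_def init)
qed

end
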